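(* For every integer $n\geqslant 0$, $$ \sum_{k=-\infty}^{\infty} (-1)^k\, b\big(n-k(3k-1)/2\big) = \begin{cases} s(n/2), & \text{for $n$ even,}\\ 0, & \text{for $n$ odd.} \end{cases} $$
   Context: For a nonnegative integer $n$: - $b(n)$ is the total number of parts in all the partitions of $n$ into odd parts minus the total number of parts in all the partitions of $n$ into distinct parts (parts counted with multiplicity). Thus $b(0)=0$, and by convention $b(m)=0$ for $m<0$. - $s(n)$ is the total number of parts in all the partitions of $n$ into an odd number of distinct parts minus the total number of parts in all the partitions of $n$ into an even number of distinct parts. For example $s(5)=1-2-2=-3$, and $s(0)=0$. The sum over $k$ runs over all integers and has only finitely many nonzero terms. *)

theory Defs
  imports "HOL-Library.Multiset" "HOL-Library.Groups_Big_Fun"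
begin

definition partitions :: "nat \<Rightarrow> nat multiset set" where
  "partitions n = {P. 0 \<notin># P \<and> sum_mset P = n}"

definition odd_partitions :: "nat \<Rightarrow> nat multiset set" where
  "odd_partitions n = {P \<in> partitions n. \<forall>p \<in># P. odd p}"

definition distinct_partitions :: "nat \<Rightarrow> nat multiset set" where
  "distinct_partitions n = {P \<in> partitions n. \<forall>p. count P p \<le> 1}"

definition b :: "int \<Rightarrow> int" where
  "b m = (if m < 0 then 0 else
     (\<Sum>P \<in> odd_partitions (nat m). int (size P)) -
     (\<Sum>P \<in> distinct_partitions (nat m). int (size P)))"

definition s :: "nat \<Rightarrow> int" where
  "s n =
     (\<Sum>P | P \<in> distinct_partitions n \<and> odd (size P). int (size P)) -
     (\<Sum>P | P \<in> distinct_partitions n \<and> even (size P). int (size P))"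

text \<open>The sums above range over finite sets, so they do not take the default value 0
  of a sum over an infinite set.\<close>

lemma finite_partitions: "finite (partitions n)"
proof (rule finite_subset)
  show "partitions n \<subseteq> mset ` {xs. set xs \<subseteq> {..n} \<and> length xs \<le> n}"
  proof
    fix P assume P: "P \<in> partitions n"
    have "size P \<le> sum_mset P" if "0 \<notin># P" for P :: "nat multiset"
      using that by (induction P) auto
    then have len: "size P \<le> n" using P by (auto simp: partitions_def)
    have le: "p \<le> n" if "p \<in># P" for p
      using P that by (auto simp: partitions_def dest!: multi_member_split)
    obtain xs where xs: "mset xs = P" using ex_mset by blast
    have "xs \<in> {xs. set xs \<subseteq> {..n} \<and> length xs \<le> n}"
      using len le xs by auto
    then show "P \<in> mset ` {xs. set xs \<subseteq> {..n} \<and> length xs \<le> n}"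
      using xs by blast
  qed
  show "finite (mset ` {xs :: nat list. set xs \<subseteq> {..n} \<and> length xs \<le> n})"
    by (intro finite_imageI finite_lists_length_le) simp
qed

lemma finite_odd_partitions: "finite (odd_partitions n)"
  using finite_partitions[of n] by (simp add: odd_partitions_def)

lemma finite_distinct_partitions: "finite (distinct_partitions n)"
  using finite_partitions[of n] by (simp add: distinct_partitions_def)

text \<open>The sum over all integers is \<^const>\<open>Sum_any\<close>, which is 0 by convention if
  infinitely many terms are nonzero; this case does not occur here.\<close>

lemma finite_support_b:
  "finite {k :: int. (-1) ^ nat \<bar>k\<bar> * b (int n - (k * (3 * k - 1)) div 2) \<noteq> 0}"
proof (rule finite_subset)
  show "{k :: int. (-1) ^ nat \<bar>k\<bar> * b (int n - (k * (3 * k - 1)) div 2) \<noteq> 0}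
    \<subseteq> {- int n..int n}"
  proof
    fix k :: int
    assume "k \<in> {k. (-1) ^ nat \<bar>k\<bar> * b (int n - (k * (3 * k - 1)) div 2) \<noteq> 0}"
    then have le: "(k * (3 * k - 1)) div 2 \<le> int n"
      by (auto simp: b_def split: if_splits)
    have "2 * \<bar>k\<bar> \<le> k * (3 * k - 1)"
    proof (cases "k \<ge> 1")
      case True
      then have "k * 2 \<le> k * (3 * k - 1)" by (intro mult_left_mono) auto
      with True show ?thesis by simp
    next
      case False
      have "0 \<le> (- k) * (- k - 1)"
        using False by (cases "k = 0") (auto intro!: mult_nonpos_nonneg)
      moreover have "(- k) * (- k - 1) = k * k + k" by (simp add: algebra_simps)
      moreover have "k * (3 * k - 1) = 3 * (k * k) - k" by (simp add: algebra_simps)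
      ultimately show ?thesis using False zero_le_square[of k] by linarith
    qed
    then have "\<bar>k\<bar> \<le> (k * (3 * k - 1)) div 2" by linarith
    with le show "k \<in> {- int n..int n}" by auto
  qed
qed simp

end

theory Submission
  imports Defs "HOL-Computational_Algebra.Formal_Laurent_Series"
begin

text \<open>
  Write \<open>L m = X^m / (1 - X^m)\<close>. Marking the parts by a variable \<open>z\<close> and differentiating
  logarithmically at \<open>z = 1\<close> or \<open>z = -1\<close>, the total number of parts has generating function
  \<open>\<Prod>m odd. 1 / (1 - X^m)\<close> times \<open>\<Sum>m odd. L m\<close> for odd parts,
  \<open>\<Prod>m. (1 + X^m)\<close> times \<open>\<Sum>m. (L m - 2 * L (2 * m))\<close> for distinct parts, and \<open>s\<close> has
  \<open>\<Prod>m. (1 - X^m)\<close> times \<open>\<Sum>m. L m\<close>. Multiplying the first two by \<open>\<Prod>m. (1 - X^m)\<close>, which the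
  pentagonal number theorem expands, turns both products into \<open>\<Prod>m. (1 - X^(2 * m))\<close>, and the
  remaining difference of sums is \<open>\<Sum>m. L (2 * m)\<close>. The products are truncated at \<open>m \<le> N\<close> and
  compared modulo \<open>X^(N + 1)\<close>.
\<close>

section \<open>The pentagonal number theorem\<close>

text \<open>The summand of Shanks' finite form of Euler's theorem. The quotient of the products up
  to \<open>n\<close> and up to \<open>i\<close> is written as a product over
  \<open>{i<..n}\<close>, so that division is avoided and \<open>x\<close> may lie in any
  commutative ring.\<close>

definition shanks_term :: "'a::comm_ring_1 \<Rightarrow> nat \<Rightarrow> nat \<Rightarrow> 'a" where
  "shanks_term x n i = (-1) ^ i * (\<Prod>j\<in>{i<..n}. 1 - x ^ j) * x ^ (i * n + (i * (i + 1)) div 2)"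

lemma triangle_Suc: "(Suc i * (Suc i + 1)) div 2 = (i * (i + 1)) div 2 + Suc i"
  by simp

lemma pentagonal_exponents:
  fixes n :: nat
  shows
  "n * n + (n * (n + 1)) div 2 = (n * (3 * n + 1)) div 2"
  "n * n + (n * (n + 1)) div 2 = n + (n * (3 * n - 1)) div 2"
proof -
  have "n * (3 * n + 1) = n * (n + 1) + (n * n) * 2" by (simp add: algebra_simps)
  then show "n * n + (n * (n + 1)) div 2 = (n * (3 * n + 1)) div 2"
    by (metis add.commute div_mult_self1 zero_neq_numeral)
  have "n * (3 * n + 1) = n * (3 * n - 1) + n * 2" by (cases n) (simp_all add: algebra_simps)
  then have "(n * (3 * n + 1)) div 2 = n + (n * (3 * n - 1)) div 2"
    by (metis add.commute div_mult_self1 zero_neq_numeral)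
  then show "n * n + (n * (n + 1)) div 2 = n + (n * (3 * n - 1)) div 2"
    using \<open>n * n + (n * (n + 1)) div 2 = (n * (3 * n + 1)) div 2\<close> by simp
qed

text \<open>Passing from \<open>n\<close> to \<open>Suc n\<close> changes the summands with
  \<open>i \<le> n\<close> by a telescoping difference. Its boundary term and the new summand are
  the two new pentagonal powers.\<close>

lemma shanks_identity:
  fixes x :: "'a::comm_ring_1"
  shows "(\<Sum>i\<le>n. shanks_term x n i) =
    1 + (\<Sum>k=1..n. (-1) ^ k * (x ^ ((k * (3 * k - 1)) div 2) + x ^ ((k * (3 * k + 1)) div 2)))"
proof (induction n)
  case 0
  then show ?case by (simp add: shanks_term_def)
next
  case (Suc n)
  define p where "p k = (-1) ^ k * (x ^ ((k * (3 * k - 1)) div 2) + x ^ ((k * (3 * k + 1)) div 2))"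
    for k
  note IH = Suc.IH[folded p_def]
  \<comment> \<open>For \<open>i \<le> n\<close> this is
    \<open>(1 - x ^ i) * shanks_term x n i\<close>; at \<open>i = Suc n\<close> the product is empty
    and a signed power of \<open>x\<close> remains.\<close>
  define u where "u i = (-1) ^ i * (\<Prod>j\<in>{i..n}. 1 - x ^ j) * x ^ (i * n + (i * (i + 1)) div 2)"
    for i
  have step: "shanks_term x (Suc n) i = shanks_term x n i - (u i - u (Suc i))" if "i \<le> n" for i
  proof -
    define A where "A = (\<Prod>j\<in>{i<..n}. 1 - x ^ j)"
    have P1: "(\<Prod>j\<in>{i<..Suc n}. 1 - x ^ j) = (1 - x ^ Suc n) * A"
    proof -
      have "{i<..Suc n} = insert (Suc n) {i<..n}" using that by auto
      then show ?thesis by (simp add: A_def)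
    qed
    have P2: "(\<Prod>j\<in>{i..n}. 1 - x ^ j) = (1 - x ^ i) * A"
    proof -
      have "{i..n} = insert i {i<..n}" using that by auto
      then show ?thesis by (simp add: A_def)
    qed
    have P3: "(\<Prod>j\<in>{Suc i..n}. 1 - x ^ j) = A"
      by (simp add: A_def atLeastSucAtMost_greaterThanAtMost)
    define e where "e = x ^ (i * n + (i * (i + 1)) div 2)"
    have e1: "x ^ (i * Suc n + (i * (i + 1)) div 2) = x ^ i * e"
      by (simp add: e_def power_add algebra_simps)
    have e2: "x ^ (Suc i * n + (Suc i * (Suc i + 1)) div 2) = x ^ i * x ^ Suc n * e"
    proof -
      have "Suc i * n + (Suc i * (Suc i + 1)) div 2 = i + Suc n + (i * n + (i * (i + 1)) div 2)"
        unfolding triangle_Suc by simp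
      then show ?thesis by (simp only: e_def power_add)
    qed
    show ?thesis
      unfolding shanks_term_def u_def P1 P2 P3 e1 e2 A_def[symmetric] e_def[symmetric]
      by (simp add: algebra_simps)
  qed
  \<comment> \<open>The factor for \<open>j = 0\<close> is \<open>1 - x ^ 0\<close>.\<close>
  have u0: "u 0 = 0"
    by (auto simp: u_def intro!: prod_zero bexI[of _ 0])
  have tele: "(\<Sum>i\<le>n. u i - u (Suc i)) = u 0 - u (Suc n)"
    by (simp add: sum_telescope)
  have "(\<Sum>i\<le>Suc n. shanks_term x (Suc n) i) =
      (\<Sum>i\<le>n. shanks_term x n i - (u i - u (Suc i))) + shanks_term x (Suc n) (Suc n)"
    using step by simp
  also have "\<dots> = (\<Sum>i\<le>n. shanks_term x n i) + (u (Suc n) + shanks_term x (Suc n) (Suc n))"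
    by (simp only: sum_subtractf[of "shanks_term x n"] tele u0) simp
  \<comment> \<open>The first term carries the smaller pentagonal exponent of \<open>Suc n\<close>,
    the second the larger one.\<close>
  also have "u (Suc n) + shanks_term x (Suc n) (Suc n) = p (Suc n)"
  proof -
    have "Suc n * n + (Suc n * (Suc n + 1)) div 2 = (Suc n * (3 * Suc n - 1)) div 2"
      using pentagonal_exponents(2)[of "Suc n"] by simp
    then show ?thesis
      unfolding u_def shanks_term_def p_def pentagonal_exponents(1)[of "Suc n"]
      by (simp add: distrib_left del: mult_Suc mult_Suc_right)
  qed
  finally show ?case
    unfolding p_def[symmetric] IH by simp
qed

text \<open>The two exponents belonging to \<open>k\<close> are the values of one quadratic
  polynomial at \<open>k\<close> and \<open>- k\<close>, so both families merge into one symmetric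
  sum.\<close>

lemma shanks_identity_int:
  fixes x :: "'a::comm_ring_1"
  shows "(\<Sum>i\<le>n. shanks_term x n i) =
    (\<Sum>k\<in>{- int n..int n}. (-1) ^ nat \<bar>k\<bar> * x ^ nat ((k * (3 * k - 1)) div 2))"
proof -
  let ?f = "\<lambda>k::int. (-1) ^ nat \<bar>k\<bar> * x ^ nat ((k * (3 * k - 1)) div 2)"
  have pos: "nat ((int k * (3 * int k - 1)) div 2) = (k * (3 * k - 1)) div 2" if "k \<ge> 1" for k
  proof -
    have "int k * (3 * int k - 1) = int (k * (3 * k - 1))"
      using that by (simp add: of_nat_diff)
    then show ?thesis by (metis nat_int zdiv_int of_nat_numeral)
  qed
  have neg: "nat ((- int k * (3 * (- int k) - 1)) div 2) = (k * (3 * k + 1)) div 2" for k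
  proof -
    have "- int k * (3 * (- int k) - 1) = int (k * (3 * k + 1))"
      by (simp add: algebra_simps)
    then show ?thesis by (metis nat_int zdiv_int of_nat_numeral)
  qed
  have "(\<Sum>k\<in>{- int n..int n}. ?f k) = 1 + (\<Sum>k=1..n. ?f (int k) + ?f (- int k))"
  proof (induction n)
    case (Suc n)
    have "{- int (Suc n)..int (Suc n)} =
        insert (int (Suc n)) (insert (- int (Suc n)) {- int n..int n})"
      by auto
    then have "(\<Sum>k\<in>{- int (Suc n)..int (Suc n)}. ?f k) =
        ?f (int (Suc n)) + (?f (- int (Suc n)) + (\<Sum>k\<in>{- int n..int n}. ?f k))"
      by (simp del: of_nat_Suc)
    then show ?case
      unfolding Suc.IH by (simp add: add_ac del: of_nat_Suc)
  qed simp
  also have "(\<Sum>k=1..n. ?f (int k) + ?f (- int k)) =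
      (\<Sum>k=1..n. (-1) ^ k * (x ^ ((k * (3 * k - 1)) div 2) + x ^ ((k * (3 * k + 1)) div 2)))"
    by (intro sum.cong refl)
       (simp only: pos neg distrib_left abs_minus_cancel abs_of_nat nat_int atLeastAtMost_iff)
  finally show ?thesis
    unfolding shanks_identity ..
qed

text \<open>All terms of Shanks' sum other than the one for \<open>i = 0\<close> are divisible by \<open>x^(n + 1)\<close>.\<close>

lemma pentagonal_number_theorem_truncated:
  fixes x :: "'a::comm_ring_1"
  shows "x ^ Suc n dvd (\<Prod>m=1..n. 1 - x ^ m) -
    (\<Sum>k\<in>{- int n..int n}. (-1) ^ nat \<bar>k\<bar> * x ^ nat ((k * (3 * k - 1)) div 2))"
proof -
  have "x ^ Suc n dvd shanks_term x n i" if "i \<in> {1..n}" for i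
  proof -
    have "(1 * (1 + 1)) div 2 \<le> (i * (i + 1)) div 2"
      using that by (intro div_le_mono mult_mono) auto
    then have "1 \<le> (i * (i + 1)) div 2"
      by simp
    moreover have "n \<le> i * n"
      using that by (cases i) auto
    ultimately have "Suc n \<le> i * n + (i * (i + 1)) div 2"
      unfolding Suc_eq_plus1 by (intro add_mono)
    then show ?thesis
      unfolding shanks_term_def by (intro dvd_mult le_imp_power_dvd)
  qed
  then have "x ^ Suc n dvd (\<Sum>i=1..n. shanks_term x n i)"
    by (intro dvd_sum)
  moreover have "(\<Sum>i\<le>n. shanks_term x n i) = (\<Prod>m=1..n. 1 - x ^ m) + (\<Sum>i=1..n. shanks_term x n i)"
  proof -
    have "{..n} = insert 0 {1..n}" by auto
    moreover have "{0<..n} = {1..n}" by auto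
    ultimately show ?thesis by (simp add: shanks_term_def)
  qed
  ultimately show ?thesis
    unfolding shanks_identity_int[symmetric] by (simp add: dvd_diff_commute)
qed

section \<open>Generating functions of restricted partitions\<close>

text \<open>\<open>M\<close> holds the admissible parts and \<open>C\<close> the admissible
  multiplicities: \<open>UNIV\<close> leaves repetition free, \<open>{..1}\<close> forces distinct
  parts. The multiplicity condition also covers absent parts, hence the assumption
  \<open>0 \<in> C\<close> below.\<close>

definition restricted_partitions :: "nat set \<Rightarrow> nat set \<Rightarrow> nat \<Rightarrow> nat multiset set" where
  "restricted_partitions C M n =
     {P. set_mset P \<subseteq> M \<and> (\<forall>p. count P p \<in> C) \<and> sum_mset P = n}"

text \<open>The weight \<open>z ^ k\<close> marks parts by \<open>z\<close>; the weight
  \<open>int k * z ^ k\<close> is its image under \<open>z\<close> times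
  \<open>d/dz\<close>.\<close>

definition size_fps :: "(nat \<Rightarrow> int) \<Rightarrow> nat set \<Rightarrow> nat set \<Rightarrow> int fps" where
  "size_fps w C M = Abs_fps (\<lambda>n. \<Sum>P\<in>restricted_partitions C M n. w (size P))"

text \<open>The Euler factor of a single part \<open>m > 0\<close>: the sum of
  \<open>w c * X^(c * m)\<close> over \<open>c \<in> C\<close>.\<close>

definition part_fps :: "(nat \<Rightarrow> int) \<Rightarrow> nat set \<Rightarrow> nat \<Rightarrow> int fps" where
  "part_fps w C m = Abs_fps (\<lambda>i. if m dvd i \<and> i div m \<in> C then w (i div m) else 0)"

lemma finite_restricted_partitions: "0 \<notin> M \<Longrightarrow> finite (restricted_partitions C M n)"
  by (rule finite_subset[OF _ finite_partitions[of n]])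
     (auto simp: restricted_partitions_def partitions_def)

text \<open>A partition is determined by the multiplicity of \<open>m\<close> and by its remaining
  parts. Since \<open>m \<notin> M\<close>, the two pieces do not interfere.\<close>

lemma restricted_partitions_insert:
  assumes "m \<notin> M" "0 \<in> C"
  shows "bij_betw (\<lambda>(c, P). replicate_mset c m + P)
    (SIGMA c:{c \<in> C. c * m \<le> n}. restricted_partitions C M (n - c * m))
    (restricted_partitions C (insert m M) n)"
proof (rule bij_betw_byWitness[where f' = "\<lambda>P. (count P m, filter_mset (\<lambda>p. p \<noteq> m) P)"])
  have count0: "count P m = 0" if "set_mset P \<subseteq> M" for P
    using that assms(1) by (auto simp: count_eq_zero_iff)
  show "\<forall>a\<in>SIGMA c:{c \<in> C. c * m \<le> n}. restricted_partitions C M (n - c * m).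
      (\<lambda>P. (count P m, filter_mset (\<lambda>p. p \<noteq> m) P)) ((\<lambda>(c, P). replicate_mset c m + P) a) = a"
    by (auto simp: restricted_partitions_def count0 multiset_eq_iff)
  have split: "replicate_mset (count P m) m + filter_mset (\<lambda>p. p \<noteq> m) P = P" for P
    by (auto simp: multiset_eq_iff)
  show "\<forall>P\<in>restricted_partitions C (insert m M) n.
      (\<lambda>(c, P). replicate_mset c m + P) (count P m, filter_mset (\<lambda>p. p \<noteq> m) P) = P"
    by (simp add: split)
  show "(\<lambda>(c, P). replicate_mset c m + P) `
      (SIGMA c:{c \<in> C. c * m \<le> n}. restricted_partitions C M (n - c * m))
      \<subseteq> restricted_partitions C (insert m M) n"
    by (auto simp: restricted_partitions_def count0 sum_mset_replicate_mset split: if_splits)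
  show "(\<lambda>P. (count P m, filter_mset (\<lambda>p. p \<noteq> m) P)) ` restricted_partitions C (insert m M) n
      \<subseteq> (SIGMA c:{c \<in> C. c * m \<le> n}. restricted_partitions C M (n - c * m))"
  proof safe
    fix P assume P: "P \<in> restricted_partitions C (insert m M) n"
    have "sum_mset P = count P m * m + sum_mset (filter_mset (\<lambda>p. p \<noteq> m) P)"
      by (subst split[of P, symmetric], subst sum_mset.union) (simp add: sum_mset_replicate_mset)
    then show "count P m \<in> C" "count P m * m \<le> n"
        "filter_mset (\<lambda>p. p \<noteq> m) P \<in> restricted_partitions C M (n - count P m * m)"
      using P assms(2) by (auto simp: restricted_partitions_def)
  qed
qed

lemma fps_nth_part_fps_mult:
  assumes "m > 0"
  shows "fps_nth (part_fps w C m * F) n = (\<Sum>c | c \<in> C \<and> c * m \<le> n. w c * fps_nth F (n - c * m))"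
proof -
  have "fps_nth (part_fps w C m * F) n =
      (\<Sum>i=0..n. if m dvd i \<and> i div m \<in> C then w (i div m) * fps_nth F (n - i) else 0)"
    unfolding fps_mult_nth by (intro sum.cong) (auto simp: part_fps_def)
  also have "\<dots> = (\<Sum>i | i \<le> n \<and> m dvd i \<and> i div m \<in> C. w (i div m) * fps_nth F (n - i))"
    by (intro sum.mono_neutral_cong_right) auto
  also have "\<dots> = (\<Sum>c | c \<in> C \<and> c * m \<le> n. w c * fps_nth F (n - c * m))"
    using assms by (intro sum.reindex_bij_witness[where i = "\<lambda>c. c * m" and j = "\<lambda>i. i div m"]) auto
  finally show ?thesis .
qed

lemma fps_nth_size_fps_insert:
  assumes "m > 0" "m \<notin> M" "0 \<in> C" "0 \<notin> M"
  shows "fps_nth (size_fps w C (insert m M)) n =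
    (\<Sum>c | c \<in> C \<and> c * m \<le> n. \<Sum>P\<in>restricted_partitions C M (n - c * m). w (c + size P))"
proof -
  have "{c \<in> C. c * m \<le> n} \<subseteq> {..n}"
    using assms(1) by (auto intro: order.trans[rotated])
  then have "finite {c \<in> C. c * m \<le> n}"
    by (rule finite_subset) simp
  then show ?thesis
    using assms
    by (simp add: size_fps_def sum.Sigma finite_restricted_partitions split_def
        sum.reindex_bij_betw[OF restricted_partitions_insert[OF assms(2,3)], symmetric])
qed

lemma size_fps_empty: "0 \<in> C \<Longrightarrow> size_fps w C {} = fps_const (w 0)"
proof (rule fps_ext)
  fix n assume "0 \<in> C"
  then have "restricted_partitions C {} n = (if n = 0 then {{#}} else {})"
    by (auto simp: restricted_partitions_def)
  then show "fps_nth (size_fps w C {}) n = fps_nth (fps_const (w 0)) n"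
    by (simp add: size_fps_def)
qed

lemma size_fps_power_insert:
  assumes "m > 0" "m \<notin> M" "0 \<in> C" "0 \<notin> M"
  shows "size_fps (\<lambda>k. z ^ k) C (insert m M) =
    part_fps (\<lambda>k. z ^ k) C m * size_fps (\<lambda>k. z ^ k) C M"
  unfolding fps_eq_iff fps_nth_size_fps_insert[OF assms] fps_nth_part_fps_mult[OF assms(1)]
  by (simp add: size_fps_def power_add sum_distrib_left)

text \<open>The product rule, read off from \<open>(c + k) * z ^ (c + k) = (c * z ^ c) * z ^ k + z ^
  c * (k * z ^ k)\<close>.\<close>

lemma size_fps_derivative_insert:
  assumes "m > 0" "m \<notin> M" "0 \<in> C" "0 \<notin> M"
  shows "size_fps (\<lambda>k. int k * z ^ k) C (insert m M) =
    part_fps (\<lambda>k. int k * z ^ k) C m * size_fps (\<lambda>k. z ^ k) C M +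
    part_fps (\<lambda>k. z ^ k) C m * size_fps (\<lambda>k. int k * z ^ k) C M"
  unfolding fps_eq_iff fps_add_nth fps_nth_size_fps_insert[OF assms]
    fps_nth_part_fps_mult[OF assms(1)]
  by (simp add: size_fps_def power_add sum_distrib_left sum.distrib algebra_simps)

context
  fixes z :: int and C M :: "nat set"
  assumes M: "finite M" "0 \<notin> M" and C: "0 \<in> C"
begin

lemma size_fps_power: "size_fps (\<lambda>k. z ^ k) C M = (\<Prod>m\<in>M. part_fps (\<lambda>k. z ^ k) C m)"
  using M
proof (induction M)
  case empty
  then show ?case using C by (simp add: size_fps_empty)
next
  case (insert m M)
  then show ?case
    using C by (simp add: size_fps_power_insert)
qed

text \<open>Logarithmic differentiation without division: \<open>h m\<close> is the logarithmic
  derivative of the factor of \<open>m\<close>, and these add up over the product.\<close>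

lemma size_fps_derivative:
  assumes h: "\<And>m. m \<in> M \<Longrightarrow>
    part_fps (\<lambda>k. int k * z ^ k) C m = part_fps (\<lambda>k. z ^ k) C m * h m"
  shows "size_fps (\<lambda>k. int k * z ^ k) C M = (\<Prod>m\<in>M. part_fps (\<lambda>k. z ^ k) C m) * (\<Sum>m\<in>M. h m)"
proof -
  have "size_fps (\<lambda>k. int k * z ^ k) C M = size_fps (\<lambda>k. z ^ k) C M * (\<Sum>m\<in>M. h m)"
    using M h
  proof (induction M)
    case empty
    then show ?case using C by (simp add: size_fps_empty)
  next
    case (insert m M)
    have m: "m > 0" "m \<notin> M" "0 \<in> C" "0 \<notin> M"
      using insert.hyps insert.prems C by auto
    have IH: "size_fps (\<lambda>k. int k * z ^ k) C M = size_fps (\<lambda>k. z ^ k) C M * (\<Sum>m\<in>M. h m)"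
      using insert.prems by (intro insert.IH) auto
    show ?case
      unfolding size_fps_power_insert[OF m] size_fps_derivative_insert[OF m] IH
        insert.prems(2)[OF insertI1] using insert.hyps
      by (simp add: algebra_simps)
  qed
  then show ?thesis
    by (simp only: size_fps_power)
qed

end

section \<open>Lambert series\<close>

text \<open>For \<open>m > 0\<close> this is the series \<open>L m\<close> of the overview; the
  condition \<open>i > 0\<close> removes the constant term of the geometric series.\<close>

definition lambert_fps :: "nat \<Rightarrow> int fps" where
  "lambert_fps m = Abs_fps (\<lambda>i. if i > 0 \<and> m dvd i then 1 else 0)"

lemma fps_nth_one_minus_X_power_mult:
  "fps_nth ((1 - fps_X ^ m) * F) i = fps_nth F i - (if i < m then 0 else fps_nth F (i - m))"
  for F :: "int fps"
  by (simp add: left_diff_distrib fps_X_power_mult_nth)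

lemma one_minus_X_power_mult_lambert_fps:
  assumes "m > 0"
  shows "(1 - fps_X ^ m) * lambert_fps m = fps_X ^ m"
proof (rule fps_ext)
  fix i
  show "fps_nth ((1 - fps_X ^ m) * lambert_fps m) i = fps_nth (fps_X ^ m :: int fps) i"
    unfolding fps_nth_one_minus_X_power_mult using assms
    by (auto simp: lambert_fps_def fps_X_power_nth dvd_diff_nat not_less dest: dvd_imp_le
        dvd_diffD)
qed

lemma part_fps_distinct:
  assumes "m > 0"
  shows "part_fps w {..1} m = fps_const (w 0) + fps_const (w 1) * fps_X ^ m"
  using assms by (intro fps_ext) (auto simp: part_fps_def fps_X_power_nth le_Suc_eq elim!: dvdE)

lemma one_minus_X_power_nonzero: "m > 0 \<Longrightarrow> (1 - fps_X ^ m :: int fps) \<noteq> 0"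
  by (auto simp: fps_eq_iff fps_X_power_nth intro!: exI[of _ 0])

text \<open>The geometric series. The weight is kept as \<open>1 ^ k\<close> to match the lemmas on
  \<open>size_fps\<close> at \<open>z = 1\<close>.\<close>

lemma one_minus_X_power_mult_part_fps_UNIV:
  assumes "m > 0"
  shows "(1 - fps_X ^ m) * part_fps (\<lambda>k. 1 ^ k) UNIV m = 1"
proof (rule fps_ext)
  fix i
  show "fps_nth ((1 - fps_X ^ m) * part_fps (\<lambda>k. 1 ^ k) UNIV m) i = fps_nth 1 i"
    unfolding fps_nth_one_minus_X_power_mult using assms
    by (auto simp: part_fps_def not_less dest: dvd_imp_le dvd_diffD)
qed

lemma part_fps_UNIV_derivative:
  assumes "m > 0"
  shows "part_fps (\<lambda>k. int k * 1 ^ k) UNIV m = part_fps (\<lambda>k. 1 ^ k) UNIV m * lambert_fps m"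
proof -
  \<comment> \<open>Multiplication by \<open>1 - X^m\<close> takes differences of the coefficients
    \<open>k\<close> and \<open>k - 1\<close> at successive multiples of \<open>m\<close>, leaving 1
    for every \<open>k \<ge> 1\<close>.\<close>
  have "(1 - fps_X ^ m) * part_fps (\<lambda>k. int k) UNIV m = lambert_fps m"
  proof (rule fps_ext)
    fix i
    show "fps_nth ((1 - fps_X ^ m) * part_fps (\<lambda>k. int k) UNIV m) i = fps_nth (lambert_fps m) i"
    proof (cases "m dvd i")
      case True
      then obtain c where "i = m * c" by (elim dvdE)
      then show ?thesis
        unfolding fps_nth_one_minus_X_power_mult using assms
        by (cases c) (auto simp: part_fps_def lambert_fps_def)
    next
      case False
      then show ?thesis
        unfolding fps_nth_one_minus_X_power_mult using assms
        by (auto simp: part_fps_def lambert_fps_def not_less dest: dvd_diffD)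
    qed
  qed
  then have "(1 - fps_X ^ m) * part_fps (\<lambda>k. int k) UNIV m =
      (1 - fps_X ^ m) * (part_fps (\<lambda>k. 1) UNIV m * lambert_fps m)"
    using one_minus_X_power_mult_part_fps_UNIV[OF assms] by (simp flip: mult.assoc)
  then show ?thesis
    using one_minus_X_power_nonzero[OF assms] by simp
qed

text \<open>With \<open>Y = X^m\<close>, the logarithmic derivative of \<open>1 + z * Y\<close> at
  \<open>z = 1\<close> is \<open>Y / (1 + Y) = Y / (1 - Y) - 2 * Y^2 / (1 - Y^2)\<close>.\<close>

lemma part_fps_distinct_derivative:
  assumes "m > 0"
  shows "part_fps (\<lambda>k. int k * 1 ^ k) {..1} m =
    part_fps (\<lambda>k. 1 ^ k) {..1} m * (lambert_fps m - 2 * lambert_fps (2 * m))"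
proof -
  let ?X = "fps_X ^ m :: int fps"
  have L1: "(1 - ?X) * lambert_fps m = ?X"
    using one_minus_X_power_mult_lambert_fps[OF assms] .
  have "(1 - ?X * ?X) * lambert_fps (2 * m) = ?X * ?X"
    using one_minus_X_power_mult_lambert_fps[of "2 * m"] assms by (simp add: mult_2 power_add)
  then have L2: "(1 - ?X) * ((1 + ?X) * lambert_fps (2 * m)) = ?X * ?X"
    by (simp add: algebra_simps)
  have "(1 - ?X) * ((1 + ?X) * (lambert_fps m - 2 * lambert_fps (2 * m))) =
      (1 + ?X) * ((1 - ?X) * lambert_fps m) - 2 * ((1 - ?X) * ((1 + ?X) * lambert_fps (2 * m)))"
    by (simp add: algebra_simps)
  also have "\<dots> = (1 - ?X) * ?X"
    unfolding L1 L2 by (simp add: algebra_simps)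
  finally have "(1 + ?X) * (lambert_fps m - 2 * lambert_fps (2 * m)) = ?X"
    using one_minus_X_power_nonzero[OF assms] by simp
  then show ?thesis
    unfolding part_fps_distinct[OF assms] by simp
qed

lemma part_fps_signed_distinct_derivative:
  assumes "m > 0"
  shows "part_fps (\<lambda>k. int k * (-1) ^ k) {..1} m = part_fps (\<lambda>k. (-1) ^ k) {..1} m * (- lambert_fps m)"
  using one_minus_X_power_mult_lambert_fps[OF assms]
  unfolding part_fps_distinct[OF assms] by (simp flip: fps_const_neg)

section \<open>The generating functions of \<open>b\<close> and \<open>s\<close>\<close>

lemma part_le_sum_mset: "p \<in># P \<Longrightarrow> p \<le> sum_mset P" for P :: "nat multiset"
  by (auto dest!: multi_member_split)

text \<open>No part exceeds the sum, so cutting the parts off at any \<open>N \<ge> n\<close> loses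
  nothing and makes the products finite.\<close>

lemma odd_partitions_eq:
  assumes "n \<le> N"
  shows "odd_partitions n = restricted_partitions UNIV {m \<in> {1..N}. odd m} n"
  using assms
  by (auto simp: odd_partitions_def partitions_def restricted_partitions_def Suc_le_eq
      intro: odd_pos dest: part_le_sum_mset)

lemma distinct_partitions_eq:
  assumes "n \<le> N"
  shows "distinct_partitions n = restricted_partitions {..1} {1..N} n"
  using assms
  by (auto simp: distinct_partitions_def partitions_def restricted_partitions_def Suc_le_eq
      intro!: Nat.gr0I order.trans[OF part_le_sum_mset])

lemma b_conv_fps_nth:
  assumes "n \<le> N"
  shows "b (int n) = fps_nth (size_fps (\<lambda>k. int k * 1 ^ k) UNIV {m \<in> {1..N}. odd m} -
    size_fps (\<lambda>k. int k * 1 ^ k) {..1} {1..N}) n"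
  using assms by (simp add: b_def size_fps_def odd_partitions_eq distinct_partitions_eq)

text \<open>The minus sign appears because \<open>(-1) ^ size P\<close> counts even sizes
  positively, whereas \<open>s\<close> counts odd sizes positively.\<close>

lemma s_conv_fps_nth:
  assumes "n \<le> N"
  shows "s n = - fps_nth (size_fps (\<lambda>k. int k * (-1) ^ k) {..1} {1..N}) n"
proof -
  let ?D = "distinct_partitions n"
  have "(\<Sum>P\<in>?D. int (size P) * (-1) ^ size P) =
      (\<Sum>P | P \<in> ?D \<and> even (size P). int (size P) * (-1) ^ size P) +
      (\<Sum>P | P \<in> ?D \<and> odd (size P). int (size P) * (-1) ^ size P)"
    by (subst sum.union_disjoint[symmetric])
       (auto simp: finite_distinct_partitions intro!: sum.cong)
  then show ?thesis
    unfolding s_def size_fps_def fps_nth_Abs_fps distinct_partitions_eq[OF assms, symmetric]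
    by (simp add: sum_negf)
qed

text \<open>The geometric series cancel the odd factors of the full product. The even factors left
  over stop at \<open>N\<close>, unlike those in \<open>size_fps_distinct\<close>, which reach
  \<open>2 * N\<close>.\<close>

lemma size_fps_odd:
  "(\<Prod>m=1..N. 1 - fps_X ^ m) * size_fps (\<lambda>k. int k * 1 ^ k) UNIV {m \<in> {1..N}. odd m} =
   (\<Prod>m | m \<in> {1..N} \<and> even m. 1 - fps_X ^ m) * (\<Sum>m | m \<in> {1..N} \<and> odd m. lambert_fps m)"
proof -
  let ?O = "{m \<in> {1..N}. odd m}" and ?E = "{m \<in> {1..N}. even m}"
  have split: "(\<Prod>m=1..N. 1 - fps_X ^ m :: int fps) =
      (\<Prod>m\<in>?E. 1 - fps_X ^ m) * (\<Prod>m\<in>?O. 1 - fps_X ^ m)"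
    by (subst prod.union_disjoint[symmetric]) (auto intro!: prod.cong)
  have "(\<Prod>m\<in>?O. 1 - fps_X ^ m) * (\<Prod>m\<in>?O. part_fps (\<lambda>k. 1 ^ k) UNIV m) = 1"
    by (subst prod.distrib[symmetric], intro prod.neutral)
       (auto simp: one_minus_X_power_mult_part_fps_UNIV)
  moreover have "size_fps (\<lambda>k. int k * 1 ^ k) UNIV ?O =
      (\<Prod>m\<in>?O. part_fps (\<lambda>k. 1 ^ k) UNIV m) * (\<Sum>m\<in>?O. lambert_fps m)"
    by (rule size_fps_derivative[OF _ _ _ part_fps_UNIV_derivative]) auto
  ultimately show ?thesis
    unfolding split by (simp add: mult.assoc)
qed

text \<open>Factorwise, \<open>(1 - X^m) * (1 + X^m) = 1 - X^(2 * m)\<close>.\<close>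

lemma size_fps_distinct:
  "(\<Prod>m=1..N. 1 - fps_X ^ m) * size_fps (\<lambda>k. int k * 1 ^ k) {..1} {1..N} =
   (\<Prod>m=1..N. 1 - fps_X ^ (2 * m)) * (\<Sum>m=1..N. lambert_fps m - 2 * lambert_fps (2 * m))"
proof -
  have "size_fps (\<lambda>k. int k * 1 ^ k) {..1} {1..N} = (\<Prod>m=1..N. part_fps (\<lambda>k. 1 ^ k) {..1} m) *
      (\<Sum>m=1..N. lambert_fps m - 2 * lambert_fps (2 * m))"
    by (rule size_fps_derivative[OF _ _ _ part_fps_distinct_derivative]) auto
  moreover have "(\<Prod>m=1..N. 1 - fps_X ^ m) * (\<Prod>m=1..N. part_fps (\<lambda>k. 1 ^ k) {..1} m) =
      (\<Prod>m=1..N. 1 - fps_X ^ (2 * m))"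
    by (subst prod.distrib[symmetric], intro prod.cong)
       (auto simp: part_fps_distinct[unfolded One_nat_def] algebra_simps mult_2_right power_add)
  ultimately show ?thesis
    by (simp flip: mult.assoc)
qed

lemma size_fps_signed_distinct:
  "size_fps (\<lambda>k. int k * (-1) ^ k) {..1} {1..N} =
   - ((\<Prod>m=1..N. 1 - fps_X ^ m) * (\<Sum>m=1..N. lambert_fps m))"
proof -
  have "size_fps (\<lambda>k. int k * (-1) ^ k) {..1} {1..N} =
      (\<Prod>m=1..N. part_fps (\<lambda>k. (-1) ^ k) {..1} m) * (\<Sum>m=1..N. - lambert_fps m)"
    by (rule size_fps_derivative[OF _ _ _ part_fps_signed_distinct_derivative]) auto
  also have "(\<Prod>m=1..N. part_fps (\<lambda>k. (-1) ^ k) {..1} m) = (\<Prod>m=1..N. 1 - fps_X ^ m)"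
    by (intro prod.cong) (auto simp: part_fps_distinct[unfolded One_nat_def] simp flip: fps_const_neg)
  finally show ?thesis
    by (simp add: sum_negf)
qed

section \<open>Comparison modulo powers of \<open>X\<close>\<close>

lemma fps_nth_eq_if_X_power_dvd:
  fixes f g :: "'a::comm_ring_1 fps"
  assumes "fps_X ^ Suc N dvd f - g" "n \<le> N"
  shows "fps_nth f n = fps_nth g n"
proof -
  obtain h where "f - g = fps_X ^ Suc N * h" using assms(1) by (elim dvdE)
  then have "fps_nth (f - g) n = 0"
    using assms(2) by (simp add: fps_X_power_mult_nth del: power_Suc)
  then show ?thesis by simp
qed

lemma X_power_dvd_lambert_fps:
  assumes "N < m"
  shows "fps_X ^ Suc N dvd lambert_fps m"
proof -
  have "lambert_fps m = fps_X ^ m * (1 + lambert_fps m)"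
    using one_minus_X_power_mult_lambert_fps[of m] assms by (simp add: algebra_simps)
  moreover have "fps_X ^ Suc N dvd (fps_X ^ m :: int fps)"
    using assms by (intro le_imp_power_dvd) simp
  ultimately show ?thesis
    by (metis dvd_mult2)
qed

lemma dvd_prod_one_minus:
  fixes f :: "'b \<Rightarrow> 'a::comm_ring_1"
  assumes "\<And>i. i \<in> A \<Longrightarrow> x dvd f i"
  shows "x dvd (\<Prod>i\<in>A. 1 - f i) - 1"
  using assms
proof (induction A rule: infinite_finite_induct)
  case (insert i A)
  have "(\<Prod>i\<in>insert i A. 1 - f i) - 1 = ((\<Prod>i\<in>A. 1 - f i) - 1) - f i * (\<Prod>i\<in>A. 1 - f i)"
    using insert.hyps by (simp add: algebra_simps)
  moreover have "x dvd (\<Prod>i\<in>A. 1 - f i) - 1" "x dvd f i"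
    using insert by auto
  ultimately show ?case
    by (metis dvd_diff dvd_mult2)
qed auto

lemma doubles_atLeastAtMost:
  "(\<lambda>m. 2 * m) ` {1..N} = {m \<in> {1..N}. even m} \<union> {m \<in> {N<..2 * N}. even m}" for N :: nat
  by (auto simp: image_iff elim!: evenE)

text \<open>The two products differ by the factors with even exponent in \<open>{N<..2 * N}\<close>,
  each congruent to 1 modulo \<open>X^(N + 1)\<close>.\<close>

lemma prod_even_cong:
  "fps_X ^ Suc N dvd (\<Prod>m | m \<in> {1..N} \<and> even m. 1 - fps_X ^ m) -
     (\<Prod>m=1..N. 1 - fps_X ^ (2 * m) :: int fps)"
proof -
  let ?E = "{m \<in> {1..N}. even m}" and ?R = "{m \<in> {N<..2 * N}. even m}"
  let ?p = "\<lambda>A. \<Prod>m\<in>A. 1 - fps_X ^ m :: int fps"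
  have "(\<Prod>m=1..N. 1 - fps_X ^ (2 * m) :: int fps) = ?p ((\<lambda>m. 2 * m) ` {1..N})"
    by (subst prod.reindex) (auto simp: inj_on_def)
  also have "\<dots> = ?p ?E * ?p ?R"
    unfolding doubles_atLeastAtMost by (rule prod.union_disjoint) auto
  finally have "?p ?E - (\<Prod>m=1..N. 1 - fps_X ^ (2 * m)) = - (?p ?E * (?p ?R - 1))"
    by (simp add: algebra_simps)
  moreover have "fps_X ^ Suc N dvd ?p ?R - 1"
    by (intro dvd_prod_one_minus le_imp_power_dvd) auto
  ultimately show ?thesis
    by (simp only: dvd_minus_iff dvd_mult)
qed

text \<open>The excess terms have index above \<open>N\<close>, so they vanish modulo
  \<open>X^(N + 1)\<close>.\<close>

lemma sum_even_cong:
  "fps_X ^ Suc N dvd (\<Sum>m | m \<in> {1..N} \<and> even m. lambert_fps m) - (\<Sum>m=1..N. lambert_fps (2 * m))"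
proof -
  let ?E = "{m \<in> {1..N}. even m}" and ?R = "{m \<in> {N<..2 * N}. even m}"
  have "(\<Sum>m=1..N. lambert_fps (2 * m)) = sum lambert_fps ((\<lambda>m. 2 * m) ` {1..N})"
    by (subst sum.reindex) (auto simp: inj_on_def)
  also have "\<dots> = sum lambert_fps ?E + sum lambert_fps ?R"
    unfolding doubles_atLeastAtMost by (rule sum.union_disjoint) auto
  moreover have "fps_X ^ Suc N dvd sum lambert_fps ?R"
    by (intro dvd_sum X_power_dvd_lambert_fps) auto
  ultimately show ?thesis
    by simp
qed

lemma prod_mult_b_cong:
  "fps_X ^ Suc N dvd (\<Prod>m=1..N. 1 - fps_X ^ m) *
     (size_fps (\<lambda>k. int k * 1 ^ k) UNIV {m \<in> {1..N}. odd m} -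
      size_fps (\<lambda>k. int k * 1 ^ k) {..1} {1..N}) -
     (\<Prod>m=1..N. 1 - fps_X ^ (2 * m)) * (\<Sum>m=1..N. lambert_fps (2 * m))"
proof -
  define A where "A = (\<Prod>m | m \<in> {1..N} \<and> even m. 1 - fps_X ^ m :: int fps)"
  define B where "B = (\<Prod>m=1..N. 1 - fps_X ^ (2 * m) :: int fps)"
  define U where "U = (\<Sum>m | m \<in> {1..N} \<and> odd m. lambert_fps m)"
  define V where "V = (\<Sum>m | m \<in> {1..N} \<and> even m. lambert_fps m)"
  define W where "W = (\<Sum>m=1..N. lambert_fps (2 * m))"
  have "(\<Sum>m=1..N. lambert_fps m) = U + V"
    unfolding U_def V_def by (subst sum.union_disjoint[symmetric]) (auto intro!: sum.cong)
  then have L: "(\<Sum>m=1..N. lambert_fps m - 2 * lambert_fps (2 * m)) = U + V - 2 * W"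
    by (simp add: sum_subtractf W_def sum_distrib_left)
  have "(\<Prod>m=1..N. 1 - fps_X ^ m) * (size_fps (\<lambda>k. int k * 1 ^ k) UNIV {m \<in> {1..N}. odd m} -
      size_fps (\<lambda>k. int k * 1 ^ k) {..1} {1..N}) - B * W = A * U - B * (U + V - 2 * W) - B * W"
    unfolding right_diff_distrib[of "\<Prod>m=1..N. 1 - fps_X ^ m"] size_fps_odd size_fps_distinct L
      A_def B_def U_def ..
  \<comment> \<open>The subtracted \<open>B * W\<close> absorbs one of the two copies of
    \<open>W\<close>; what remains pairs the congruent quantities \<open>A\<close>, \<open>B\<close>
    and \<open>V\<close>, \<open>W\<close>.\<close>
  also have "\<dots> = (A - B) * U - B * (V - W)"
    by (simp add: algebra_simps)
  finally show ?thesis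
    using prod_even_cong[of N, folded A_def B_def] sum_even_cong[of N, folded V_def W_def]
    by (simp only: B_def[symmetric] W_def[symmetric] dvd_diff dvd_mult dvd_mult2)
qed

section \<open>Substituting the square of \<open>X\<close>, and the final comparison of
  coefficients\<close>

lemma fps_compose_X_square_lambert_fps:
  assumes "m > 0"
  shows "lambert_fps m oo fps_X ^ 2 = lambert_fps (2 * m)"
  using assms
  by (intro fps_ext) (auto simp: fps_nth_compose_X_power lambert_fps_def elim!: dvdE)

text \<open>The product arises from the one for \<open>s\<close> by replacing \<open>X\<close> with
  \<open>X^2\<close>; this is the source of the case distinction in the theorem.\<close>

lemma fps_nth_even_product:
  "fps_nth ((\<Prod>m=1..N. 1 - fps_X ^ (2 * m)) * (\<Sum>m=1..N. lambert_fps (2 * m))) n =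
     (if even n then fps_nth ((\<Prod>m=1..N. 1 - fps_X ^ m) * (\<Sum>m=1..N. lambert_fps m)) (n div 2) else 0)"
proof -
  have *: "((\<Prod>m=1..N. 1 - fps_X ^ m) * (\<Sum>m=1..N. lambert_fps m)) oo fps_X ^ 2 =
      (\<Prod>m=1..N. 1 - fps_X ^ (2 * m)) * (\<Sum>m=1..N. lambert_fps (2 * m))"
    by (simp add: fps_compose_mult_distrib fps_compose_prod_distrib fps_compose_sum_distrib
        fps_compose_sub_distrib fps_X_power_compose fps_compose_X_square_lambert_fps power_mult)
  show ?thesis
    unfolding *[symmetric] fps_nth_compose_X_power ..
qed

text \<open>For \<open>k \<noteq> 0\<close> the factors \<open>k\<close> and
  \<open>3 * k - 1\<close> have the same sign, and the second has absolute value at least 2.\<close>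

lemma abs_le_pentagonal: "\<bar>k\<bar> \<le> (k * (3 * k - 1)) div 2" for k :: int
proof -
  have "\<bar>k\<bar> * 2 \<le> \<bar>k\<bar> * \<bar>3 * k - 1\<bar>" if "k \<noteq> 0"
    using that by (intro mult_left_mono) auto
  moreover have "\<bar>k\<bar> * \<bar>3 * k - 1\<bar> = k * (3 * k - 1)"
    by (cases "k \<ge> 1") (simp_all add: abs_if algebra_simps)
  ultimately have "\<bar>k\<bar> * 2 \<le> k * (3 * k - 1)"
    by (cases "k = 0") simp_all
  then show ?thesis
    by linarith
qed

theorem corollary2p2:
  fixes n :: nat
  shows "Sum_any (\<lambda>k::int. (-1) ^ nat \<bar>k\<bar> * b (int n - (k * (3 * k - 1)) div 2)) =
    (if even n then s (n div 2) else 0)"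
proof -
  define g where "g k = (k * (3 * k - 1)) div 2" for k :: int
  have g_ge: "\<bar>k\<bar> \<le> g k" for k
    unfolding g_def by (rule abs_le_pentagonal)
  then have g_nonneg: "g k \<ge> 0" for k
    by (rule order.trans[OF abs_ge_zero])
  define F where "F = size_fps (\<lambda>k. int k * 1 ^ k) UNIV {m \<in> {1..n}. odd m} -
    size_fps (\<lambda>k. int k * 1 ^ k) {..1} {1..n}"
  \<comment> \<open>Shifting the argument of \<open>b\<close> is multiplication by a power of
    \<open>X\<close>. If \<open>g k > n\<close>, both sides are 0, by the convention for
    \<open>b\<close> at negative arguments.\<close>
  have summand: "(-1) ^ nat \<bar>k\<bar> * b (int n - g k) =
      fps_nth ((-1) ^ nat \<bar>k\<bar> * fps_X ^ nat (g k) * F) n" for k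
  proof -
    have "b (int n - g k) = fps_nth (fps_X ^ nat (g k) * F) n"
    proof (cases "g k \<le> int n")
      case True
      then have diff: "int n - g k = int (n - nat (g k))" using g_nonneg[of k] by simp
      have "b (int n - g k) = fps_nth F (n - nat (g k))"
        unfolding F_def diff by (rule b_conv_fps_nth[OF diff_le_self])
      then show ?thesis
        using True g_nonneg[of k] by (simp add: fps_X_power_mult_nth nat_less_iff)
    qed (auto simp: b_def fps_X_power_mult_nth)
    then show ?thesis
      by (cases "even (nat \<bar>k\<bar>)") auto
  qed
  have "Sum_any (\<lambda>k. (-1) ^ nat \<bar>k\<bar> * b (int n - g k)) =
      (\<Sum>k\<in>{- int n..int n}. (-1) ^ nat \<bar>k\<bar> * b (int n - g k))"
  proof (rule Sum_any.expand_superset)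
    show "{k. (-1) ^ nat \<bar>k\<bar> * b (int n - g k) \<noteq> 0} \<subseteq> {- int n..int n}"
    proof
      fix k assume "k \<in> {k. (-1) ^ nat \<bar>k\<bar> * b (int n - g k) \<noteq> 0}"
      then have "g k \<le> int n" by (auto simp: b_def split: if_splits)
      with g_ge[of k] show "k \<in> {- int n..int n}" by auto
    qed
  qed simp
  also have "\<dots> = fps_nth ((\<Sum>k\<in>{- int n..int n}. (-1) ^ nat \<bar>k\<bar> * fps_X ^ nat (g k)) * F) n"
    unfolding summand by (simp add: sum_distrib_right fps_sum_nth)
  \<comment> \<open>The range \<open>{- int n..int n}\<close> is the one in the truncated pentagonal
    number theorem, whose error is divisible by \<open>X^(n + 1)\<close> and so does not reach
    coefficient \<open>n\<close>.\<close>
  also have "\<dots> = fps_nth ((\<Prod>m=1..n. 1 - fps_X ^ m) * F) n"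
  proof (rule fps_nth_eq_if_X_power_dvd[symmetric])
    show "fps_X ^ Suc n dvd (\<Prod>m=1..n. 1 - fps_X ^ m) * F -
        (\<Sum>k\<in>{- int n..int n}. (-1) ^ nat \<bar>k\<bar> * fps_X ^ nat (g k)) * F"
      unfolding g_def left_diff_distrib[symmetric]
      by (intro dvd_mult2 pentagonal_number_theorem_truncated)
  qed simp
  also have "\<dots> = fps_nth ((\<Prod>m=1..n. 1 - fps_X ^ (2 * m)) * (\<Sum>m=1..n. lambert_fps (2 * m))) n"
    unfolding F_def by (rule fps_nth_eq_if_X_power_dvd[OF prod_mult_b_cong]) simp
  \<comment> \<open>Since \<open>n div 2 \<le> n\<close>, the truncation at \<open>n\<close> also
    serves for \<open>s (n div 2)\<close>; the minus signs of the two rewritten equations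
    cancel.\<close>
  also have "\<dots> = (if even n then s (n div 2) else 0)"
    unfolding fps_nth_even_product s_conv_fps_nth[OF div_le_dividend] size_fps_signed_distinct
    by simp
  finally show ?thesis
    unfolding g_def .
qed

end
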